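(* Let $X = (X_1,\ldots,X_n)$ be jointly distributed random variables taking values in finite sets. Let $Y$ be a (deterministic) function of $X_1,\ldots,X_n$, taking values in a finite set, and for each $i=1,\ldots,n$ let $\bar X_i$ be a finite-valued probabilistic function of $(X_i, Y)$, where $\bar X_1,\ldots,\bar X_n$ are generated independently of each other given $(X,Y)$, i.e. the joint distribution satisfies $$p(x,y,\bar x_1,\ldots,\bar x_n) = p(x)\,p(y|x)\prod_{i=1}^n p(\bar x_i | x_i, y).$$ Let $\bar X \equiv (\bar X_1,\ldots,\bar X_n, Y)$ (so $\bar X$ consists of $n+1$ variables, including $Y$). Then $$-\sum_{i=1}^n I(\bar X_i;Y) \;\le\; TC(X) - \bigl(TC(\bar X) + TC(X;Y)\bigr) \;\le\; \sum_{i=1}^n H(X_i \mid \bar X_i, Y).$$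
   Context: All random variables are discrete with finite domains. $H(\cdot)$, $H(\cdot|\cdot)$ and $I(\cdot;\cdot)$ denote Shannon entropy, conditional entropy and mutual information (base-two logarithms). For a tuple of random variables $Z=(Z_1,\ldots,Z_m)$, the total correlation is $$TC(Z) = D_{KL}\Bigl(p(z)\,\Big\|\,\prod_{j=1}^m p(z_j)\Bigr) = \sum_{j=1}^m H(Z_j) - H(Z).$$ For a further random variable $W$, the conditional total correlation is $TC(Z|W) = \sum_{j=1}^m H(Z_j|W) - H(Z|W)$, and $$TC(Z;W) = TC(Z) - TC(Z|W) = \sum_{j=1}^m I(Z_j;W) - I(Z;W).$$ In particular, $TC(\bar X) = \sum_{i=1}^n H(\bar X_i) + H(Y) - H(\bar X_1,\ldots,\bar X_n,Y)$. A random variable $V$ is a probabilistic function of $U$ if it is generated from $U$ through a conditional distribution $p(v|u)$, and is conditionally independent of the remaining input variables given $U$. *)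

theory Defs
  imports "HOL-Probability.Probability"
begin

text \<open>
  Base-two Shannon quantities of finite-valued random variables: the functionals of
  \<open>HOL-Probability.Information\<close>, taken with respect to counting measure on the ranges
  exactly as in the \<open>_Pow\<close> abbreviations there, but with the probability space \<open>M\<close> explicit.
\<close>

abbreviation entropy2 :: "'a measure \<Rightarrow> ('a \<Rightarrow> 'b) \<Rightarrow> real" where
  "entropy2 M X \<equiv> prob_space.entropy M 2 (count_space (X ` space M)) X"

abbreviation conditional_entropy2 :: "'a measure \<Rightarrow> ('a \<Rightarrow> 'b) \<Rightarrow> ('a \<Rightarrow> 'c) \<Rightarrow> real" where
  "conditional_entropy2 M X Y \<equiv>
     prob_space.conditional_entropy M 2 (count_space (X ` space M)) (count_space (Y ` space M)) X Y"

abbreviation mutual_information2 :: "'a measure \<Rightarrow> ('a \<Rightarrow> 'b) \<Rightarrow> ('a \<Rightarrow> 'c) \<Rightarrow> real" where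
  "mutual_information2 M X Y \<equiv>
     prob_space.mutual_information M 2 (count_space (X ` space M)) (count_space (Y ` space M)) X Y"

text \<open>The tuple \<open>(Z\<^sub>j)\<close>, \<open>j \<in> J\<close>, as a single random variable with values in extensional functions.\<close>

definition tuple :: "'i set \<Rightarrow> ('i \<Rightarrow> 'a \<Rightarrow> 'b) \<Rightarrow> 'a \<Rightarrow> 'i \<Rightarrow> 'b" where
  "tuple J Z = (\<lambda>\<omega>. \<lambda>j\<in>J. Z j \<omega>)"

text \<open>
  Beware of the argument order of \<^const>\<open>KL_divergence\<close>: \<open>KL_divergence b P Q\<close> is
  \<open>D\<^sub>K\<^sub>L(Q || P)\<close>, so the product of the marginals comes first.
\<close>

definition total_correlation :: "'a measure \<Rightarrow> 'i set \<Rightarrow> ('i \<Rightarrow> 'a \<Rightarrow> 'b) \<Rightarrow> real" where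
  "total_correlation M J Z =
     KL_divergence 2
       (\<Pi>\<^sub>M j\<in>J. distr M (count_space (Z j ` space M)) (Z j))
       (distr M (\<Pi>\<^sub>M j\<in>J. count_space (Z j ` space M)) (tuple J Z))"

definition conditional_total_correlation ::
    "'a measure \<Rightarrow> 'i set \<Rightarrow> ('i \<Rightarrow> 'a \<Rightarrow> 'b) \<Rightarrow> ('a \<Rightarrow> 'c) \<Rightarrow> real" where
  "conditional_total_correlation M J Z W =
     (\<Sum>j\<in>J. conditional_entropy2 M (Z j) W) - conditional_entropy2 M (tuple J Z) W"

text \<open>\<open>TC(Z;W) = TC(Z) - TC(Z|W)\<close>\<close>

definition total_correlation_reduction ::
    "'a measure \<Rightarrow> 'i set \<Rightarrow> ('i \<Rightarrow> 'a \<Rightarrow> 'b) \<Rightarrow> ('a \<Rightarrow> 'c) \<Rightarrow> real" where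
  "total_correlation_reduction M J Z W =
     total_correlation M J Z - conditional_total_correlation M J Z W"

text \<open>
  The \<open>n + 1\<close> variables \<open>(V\<^sub>1, \<dots>, V\<^sub>n, Y)\<close> as a family over \<open>{1..Suc n}\<close>; the sum type
  only serves to give all components a common type.
\<close>

definition append_var ::
    "nat \<Rightarrow> (nat \<Rightarrow> 'a \<Rightarrow> 'b) \<Rightarrow> ('a \<Rightarrow> 'c) \<Rightarrow> nat \<Rightarrow> 'a \<Rightarrow> 'b + 'c" where
  "append_var n V Y i \<omega> = (if i \<le> n then Inl (V i \<omega>) else Inr (Y \<omega>))"

text \<open>
  The factorization
  \<open>p(x, y, v\<^sub>1, \<dots>, v\<^sub>n) = p(x) p(y|x) (\<Prod>i. p(v\<^sub>i | x\<^sub>i, y))\<close>.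
  A conditional probability given a null event is \<open>0\<close> by \<^const>\<open>cond_prob\<close>; this is harmless here, since
  such a factor occurs only together with \<open>p(x) p(y|x) = 0\<close>.
\<close>

definition independent_probabilistic_functions ::
    "'a measure \<Rightarrow> nat \<Rightarrow> (nat \<Rightarrow> 'a \<Rightarrow> 'b) \<Rightarrow> ('a \<Rightarrow> 'c) \<Rightarrow> (nat \<Rightarrow> 'a \<Rightarrow> 'd) \<Rightarrow> bool" where
  "independent_probabilistic_functions M n X Y V \<longleftrightarrow>
     (\<forall>x y v.
        \<P>(\<omega> in M. (\<forall>i\<in>{1..n}. X i \<omega> = x i) \<and> Y \<omega> = y \<and> (\<forall>i\<in>{1..n}. V i \<omega> = v i)) =
        \<P>(\<omega> in M. \<forall>i\<in>{1..n}. X i \<omega> = x i)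
        * \<P>(\<omega> in M. Y \<omega> = y \<bar> \<forall>i\<in>{1..n}. X i \<omega> = x i)
        * (\<Prod>i\<in>{1..n}. \<P>(\<omega> in M. V i \<omega> = v i \<bar> X i \<omega> = x i \<and> Y \<omega> = y)))"

lemma tuple_eq_iff: "tuple J Z \<omega> = tuple J Z \<omega>' \<longleftrightarrow> (\<forall>j\<in>J. Z j \<omega> = Z j \<omega>')"
  by (auto simp: tuple_def restrict_def fun_eq_iff split: if_splits)

lemma simple_function_tuple:
  assumes "finite J" "\<And>j. j \<in> J \<Longrightarrow> simple_function M (Z j)"
  shows "simple_function M (tuple J Z)"
  unfolding simple_function_def
proof safe
  have "tuple J Z ` space M \<subseteq> (\<Pi>\<^sub>E j\<in>J. Z j ` space M)"
    by (auto simp: tuple_def)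
  moreover have "finite (\<Pi>\<^sub>E j\<in>J. Z j ` space M)"
    using assms by (intro finite_PiE) (auto dest: simple_functionD)
  ultimately show "finite (tuple J Z ` space M)"
    by (rule finite_subset)
next
  fix \<omega> assume "\<omega> \<in> space M"
  have "tuple J Z -` {tuple J Z \<omega>} \<inter> space M = {\<omega>' \<in> space M. \<forall>j\<in>J. Z j \<omega>' = Z j \<omega>}"
    by (auto simp: tuple_def restrict_def fun_eq_iff split: if_splits)
  also have "\<dots> = space M \<inter> {\<omega>' \<in> space M. \<forall>j\<in>J. \<omega>' \<in> Z j -` {Z j \<omega>} \<inter> space M}"
    by auto
  also have "\<dots> \<in> sets M"
    using assms by (intro sets.Int sets.top sets.sets_Collect_finite_All)
      (auto dest: simple_functionD(2))
  finally show "tuple J Z -` {tuple J Z \<omega>} \<inter> space M \<in> sets M" .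
qed

lemma (in information_space) entropy_simple_function:
  assumes "simple_function M X"
  shows "\<H>(X) = - (\<integral>\<omega>. log b (prob (X -` {X \<omega>} \<inter> space M)) \<partial>M)"
proof -
  let ?p = "\<lambda>x. prob (X -` {x} \<inter> space M)"
  have D: "simple_distributed M X ?p"
    by (rule simple_distributedI) (auto simp: assms)
  have "\<H>(X) = - (\<integral>x. ?p x * log b (?p x) \<partial>count_space (X ` space M))"
    using entropy_distr[OF simple_distributed[OF D]] by simp
  also have "(\<integral>x. ?p x * log b (?p x) \<partial>count_space (X ` space M)) = (\<integral>\<omega>. log b (?p (X \<omega>)) \<partial>M)"
    by (rule distributed_integral[OF simple_distributed[OF D]]) auto
  finally show ?thesis .
qed

text \<open>\<open>TC(Z) = (\<Sum>j. H(Z\<^sub>j)) - H(Z)\<close>\<close>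

theorem total_correlation_eq_entropy:
  assumes "prob_space M" and J: "finite J" and Z: "\<And>j. j \<in> J \<Longrightarrow> simple_function M (Z j)"
  shows "total_correlation M J Z = (\<Sum>j\<in>J. entropy2 M (Z j)) - entropy2 M (tuple J Z)"
proof -
  interpret prob_space M by fact
  interpret information_space M 2 by standard simp
  define p where "p j x = prob (Z j -` {x} \<inter> space M)" for j x
  define q where "q z = prob (tuple J Z -` {z} \<inter> space M)" for z
  define R where "R = (\<Pi>\<^sub>E j\<in>J. Z j ` space M)"
  define C where "C = (\<Pi>\<^sub>M j\<in>J. count_space (Z j ` space M))"
  have fin: "finite (Z j ` space M)" if "j \<in> J" for j
    using simple_functionD(1)[OF Z[OF that]] .
  have finR: "finite R" unfolding R_def using J fin by (intro finite_PiE) auto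
  have T: "simple_function M (tuple J Z)" using J Z by (rule simple_function_tuple)
  have TR: "tuple J Z ` space M \<subseteq> R" by (auto simp: tuple_def R_def)
  have meas: "Z j \<in> measurable M (count_space (Z j ` space M))" if "j \<in> J" for j
    by (auto simp: measurable_count_space_eq2 fin that simple_functionD(2)[OF Z[OF that]])
  have em: "emeasure (distr M (count_space (Z j ` space M)) (Z j)) {x} = ennreal (p j x)"
    if "j \<in> J" "x \<in> Z j ` space M" for j x
    using that meas[OF that(1)] by (simp add: emeasure_distr p_def emeasure_eq_measure)
  have C: "C = count_space R"
  proof -
    have "C = (\<Pi>\<^sub>M j\<in>J. count_space (if j \<in> J then Z j ` space M else {}))"
      unfolding C_def by (intro PiM_cong) auto
    also have "\<dots> = count_space (\<Pi>\<^sub>E j\<in>J. if j \<in> J then Z j ` space M else {})"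
      using J fin by (intro count_space_PiM_finite) (auto intro: countable_finite)
    also have "\<dots> = count_space R"
      unfolding R_def by (intro arg_cong[where f=count_space] PiE_cong) auto
    finally show ?thesis .
  qed
  have joint: "distributed M (count_space R) (tuple J Z) (\<lambda>z. ennreal (q z))"
  proof -
    have "distributed M (count_space R) (tuple J Z)
            (\<lambda>z. ennreal (if z \<in> tuple J Z ` space M then q z else 0))"
      by (rule distributed_simple_function_superset[OF T _ TR finR]) (simp add: q_def)
    moreover have "(if z \<in> tuple J Z ` space M then q z else 0) = q z" for z
    proof -
      have "z \<notin> tuple J Z ` space M \<Longrightarrow> tuple J Z -` {z} \<inter> space M = {}" by auto
      then show ?thesis by (auto simp: q_def)
    qed
    ultimately show ?thesis by simp
  qed
  have marg: "(\<Pi>\<^sub>M j\<in>J. distr M (count_space (Z j ` space M)) (Z j))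
      = density (count_space R) (\<lambda>z. ennreal (\<Prod>j\<in>J. p j (z j)))" (is "?P = _")
  proof (rule measure_eqI_finite[where A=R])
    have "sets ?P = sets C" unfolding C_def by (intro sets_PiM_cong) auto
    then show "sets ?P = Pow R" by (simp add: C)
    show "sets (density (count_space R) (\<lambda>z. ennreal (\<Prod>j\<in>J. p j (z j)))) = Pow R" by simp
    show "finite R" by fact
    fix z assume z: "z \<in> R"
    define N where "N j = (if j \<in> J then distr M (count_space (Z j ` space M)) (Z j) else return (count_space UNIV) undefined)" for j
    have N: "prob_space (N j)" for j
      unfolding N_def using meas by (auto intro: prob_space_distr prob_space_return)
    interpret product_prob_space N J by (rule product_prob_spaceI) (rule N)
    have "?P = PiM J N" by (intro PiM_cong) (auto simp: N_def)
    moreover have "{z} = (\<Pi>\<^sub>E j\<in>J. {z j})" using z by (subst PiE_singleton) (auto simp: R_def PiE_def)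
    ultimately have "emeasure ?P {z} = emeasure (PiM J N) (\<Pi>\<^sub>E j\<in>J. {z j})" by simp
    also have "\<dots> = (\<Prod>j\<in>J. emeasure (N j) {z j})"
      using J z by (intro emeasure_PiM) (auto simp: N_def R_def)
    also have "\<dots> = (\<Prod>j\<in>J. ennreal (p j (z j)))"
      using z by (intro prod.cong refl) (auto simp: N_def R_def intro!: em)
    also have "\<dots> = ennreal (\<Prod>j\<in>J. p j (z j))"
      by (intro prod_ennreal) (simp add: p_def)
    also have "\<dots> = emeasure (density (count_space R) (\<lambda>z. ennreal (\<Prod>j\<in>J. p j (z j)))) {z}"
    proof -
      have "emeasure (density (count_space R) (\<lambda>z. ennreal (\<Prod>j\<in>J. p j (z j)))) {z}
        = (\<integral>\<^sup>+x. ennreal (\<Prod>j\<in>J. p j (x j)) * indicator {z} x \<partial>count_space R)"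
        using z by (intro emeasure_density) auto
      also have "\<dots> = (\<Sum>x\<in>R. ennreal (\<Prod>j\<in>J. p j (x j)) * indicator {z} x)"
        using finR by (rule nn_integral_count_space_finite)
      also have "\<dots> = ennreal (\<Prod>j\<in>J. p j (z j))"
        using z finR by (subst sum.remove[of _ z]) (auto intro!: sum.neutral)
      finally show ?thesis by simp
    qed
    finally show "emeasure ?P {z} = \<dots>" .
  qed
  have le: "q z \<le> p j (z j)" if "j \<in> J" "z \<in> R" for j z
    unfolding p_def q_def using that simple_functionD(2)[OF Z[OF that(1)]]
    by (intro finite_measure_mono) (auto simp: tuple_def)
  have qnn: "0 \<le> q z" and pnn: "0 \<le> p j x" for z j x by (simp_all add: p_def q_def)
  have ac: "(\<Prod>j\<in>J. p j (z j)) = 0 \<Longrightarrow> q z = 0" if "z \<in> R" for z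
    using J le[OF _ that] qnn[of z] by (auto simp: prod_zero_iff intro: antisym) (metis antisym le that)
  interpret R: sigma_finite_measure "count_space R"
    using finR by (intro sigma_finite_measure_count_space_finite)
  have "total_correlation M J Z = KL_divergence 2 (density (count_space R) (\<lambda>z. ennreal (\<Prod>j\<in>J. p j (z j))))
          (density (count_space R) (\<lambda>z. ennreal (q z)))"
    unfolding total_correlation_def marg C_def[symmetric] C
    by (simp add: distributed_distr_eq_density[OF joint])
  also have "\<dots> = (\<integral>z. q z * log 2 (q z / (\<Prod>j\<in>J. p j (z j))) \<partial>count_space R)"
    using ac by (intro R.KL_density_density) (auto simp: qnn pnn prod_nonneg AE_count_space)
  also have "\<dots> = (\<integral>\<omega>. log 2 (q (tuple J Z \<omega>) / (\<Prod>j\<in>J. p j (tuple J Z \<omega> j))) \<partial>M)"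
    by (rule distributed_integral[OF joint]) (auto simp: qnn)
  also have "\<dots> = (\<integral>\<omega>. log 2 (q (tuple J Z \<omega>)) - (\<Sum>j\<in>J. log 2 (p j (Z j \<omega>))) \<partial>M)"
  proof (rule integral_cong_AE)
    have sf: "simple_function M (\<lambda>\<omega>. h (tuple J Z \<omega>))" for h :: "_ \<Rightarrow> real"
      using simple_function_compose[OF T, of h] by (simp add: comp_def)
    have sf': "simple_function M (\<lambda>\<omega>. log 2 (p j (Z j \<omega>)))" if "j \<in> J" for j
      using simple_function_compose[OF Z[OF that], of "\<lambda>x. log 2 (p j x)"] by (simp add: comp_def)
    show "(\<lambda>\<omega>. log 2 (q (tuple J Z \<omega>) / (\<Prod>j\<in>J. p j (tuple J Z \<omega> j)))) \<in> borel_measurable M"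
      by (rule borel_measurable_simple_function[OF sf])
    show "(\<lambda>\<omega>. log 2 (q (tuple J Z \<omega>)) - (\<Sum>j\<in>J. log 2 (p j (Z j \<omega>)))) \<in> borel_measurable M"
      by (intro borel_measurable_diff borel_measurable_sum borel_measurable_simple_function[OF sf]
            borel_measurable_simple_function[OF sf'])
    have "AE \<omega> in M. \<omega> \<notin> (\<Union>z\<in>{z\<in>R. q z = 0}. tuple J Z -` {z} \<inter> space M)"
      by (intro AE_not_in null_sets_UN')
         (use finR T in \<open>auto intro!: countable_finite simp: null_sets_def q_def emeasure_eq_measure dest: simple_functionD(2)\<close>)
    then show "AE \<omega> in M. log 2 (q (tuple J Z \<omega>) / (\<Prod>j\<in>J. p j (tuple J Z \<omega> j)))
          = log 2 (q (tuple J Z \<omega>)) - (\<Sum>j\<in>J. log 2 (p j (Z j \<omega>)))"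
      using AE_space
    proof eventually_elim
      case (elim \<omega>)
      let ?z = "tuple J Z \<omega>"
      have zR: "?z \<in> R" using TR elim by auto
      have q0: "0 < q ?z" using elim zR qnn[of ?z] by (auto simp: less_le)
      have p0: "0 < p j (Z j \<omega>)" if "j \<in> J" for j
        using le[OF that zR] q0 that by (auto simp: tuple_def)
      have eq: "(\<Prod>j\<in>J. p j (?z j)) = (\<Prod>j\<in>J. p j (Z j \<omega>))"
        by (intro prod.cong) (auto simp: tuple_def)
      have "log 2 (\<Prod>j\<in>J. p j (Z j \<omega>)) = (\<Sum>j\<in>J. log 2 (p j (Z j \<omega>)))"
        unfolding log_def using p0 J by (subst ln_prod) (auto simp: sum_divide_distrib less_imp_neq[symmetric])
      moreover have "0 < (\<Prod>j\<in>J. p j (Z j \<omega>))" using p0 by (intro prod_pos) auto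
      ultimately show ?case unfolding eq using q0 by (simp add: log_divide)
    qed
  qed
  also have "\<dots> = (\<integral>\<omega>. log 2 (q (tuple J Z \<omega>)) \<partial>M) - (\<Sum>j\<in>J. \<integral>\<omega>. log 2 (p j (Z j \<omega>)) \<partial>M)"
  proof -
    have int: "integrable M g" if "simple_function M g" for g :: "'a \<Rightarrow> real"
      using that by (intro integrable_simple_function) (auto simp: emeasure_eq_measure)
    have 1: "integrable M (\<lambda>\<omega>. log 2 (q (tuple J Z \<omega>)))"
      using int[OF simple_function_compose[OF T, of "\<lambda>z. log 2 (q z)"]] by (simp add: comp_def)
    have 2: "integrable M (\<lambda>\<omega>. log 2 (p j (Z j \<omega>)))" if "j \<in> J" for j
      using int[OF simple_function_compose[OF Z[OF that], of "\<lambda>x. log 2 (p j x)"]]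
      by (simp add: comp_def)
    show ?thesis
      using 1 2 by (subst Bochner_Integration.integral_diff)
        (auto intro!: Bochner_Integration.integral_sum Bochner_Integration.integrable_sum)
  qed
  also have "\<dots> = (\<Sum>j\<in>J. entropy2 M (Z j)) - entropy2 M (tuple J Z)"
    using entropy_simple_function[OF T] entropy_simple_function[OF Z]
    by (simp add: p_def q_def sum_negf)
  finally show ?thesis .
qed

lemma entropy_cong_level_sets:
  assumes "prob_space M" and X: "simple_function M X" and X': "simple_function M X'"
    and eq: "\<And>\<omega> \<omega>'. \<omega> \<in> space M \<Longrightarrow> \<omega>' \<in> space M \<Longrightarrow> X \<omega> = X \<omega>' \<longleftrightarrow> X' \<omega> = X' \<omega>'"
  shows "entropy2 M (X) = entropy2 M (X')"
proof -
  interpret prob_space M by fact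
  interpret information_space M 2 by standard simp
  have "X -` {X \<omega>} \<inter> space M = X' -` {X' \<omega>} \<inter> space M" if "\<omega> \<in> space M" for \<omega>
    using eq that by auto
  then show ?thesis
    unfolding entropy_simple_function[OF X] entropy_simple_function[OF X']
    by (intro arg_cong[where f=uminus] Bochner_Integration.integral_cong) auto
qed

text \<open>\<open>TC(V\<^sub>1, \<dots>, V\<^sub>n, Y) = (\<Sum>i. H(V\<^sub>i)) + H(Y) - H(V\<^sub>1, \<dots>, V\<^sub>n, Y)\<close>\<close>

theorem total_correlation_append_var:
  assumes "prob_space M" and V: "\<And>i. i \<in> {1..n} \<Longrightarrow> simple_function M (V i)"
    and Y: "simple_function M Y"
  shows "total_correlation M {1..Suc n} (append_var n V Y) =
    (\<Sum>i\<in>{1..n}. entropy2 M (V i)) + entropy2 M Y - entropy2 M (\<lambda>\<omega>. (tuple {1..n} V \<omega>, Y \<omega>))"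
proof -
  interpret prob_space M by fact
  interpret information_space M 2 by standard simp
  have eq1: "append_var n V Y i = (\<lambda>\<omega>. Inl (V i \<omega>))" if "i \<in> {1..n}" for i
    using that by (auto simp: append_var_def)
  have eq2: "append_var n V Y (Suc n) = (\<lambda>\<omega>. Inr (Y \<omega>))"
    by (auto simp: append_var_def)
  have sf1: "simple_function M (append_var n V Y i)" if "i \<in> {1..n}" for i
    using simple_function_compose[OF V[OF that], of Inl] that by (simp add: eq1 comp_def)
  have sf2: "simple_function M (append_var n V Y (Suc n))"
    using simple_function_compose[OF Y, of Inr] by (simp add: eq2 comp_def)
  have sf: "simple_function M (append_var n V Y i)" if "i \<in> {1..Suc n}" for i
    using sf1 sf2 that by (cases "i = Suc n") auto
  have H1: "entropy2 M (append_var n V Y i) = entropy2 M (V i)" if "i \<in> {1..n}" for i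
    using prob_space_axioms sf1[OF that] V[OF that] by (rule entropy_cong_level_sets) (simp add: eq1[OF that])
  have H2: "entropy2 M (append_var n V Y (Suc n)) = entropy2 M (Y)"
    using prob_space_axioms sf2 Y by (rule entropy_cong_level_sets) (simp add: eq2)
  have H3: "entropy2 M (tuple {1..Suc n} (append_var n V Y)) = entropy2 M (\<lambda>\<omega>. (tuple {1..n} V \<omega>, Y \<omega>))"
  proof (rule entropy_cong_level_sets[OF prob_space_axioms])
    show "simple_function M (tuple {1..Suc n} (append_var n V Y))"
      using sf by (intro simple_function_tuple) auto
    show "simple_function M (\<lambda>\<omega>. (tuple {1..n} V \<omega>, Y \<omega>))"
      using V Y by (intro simple_function_Pair simple_function_tuple) auto
    fix \<omega> \<omega>'
    have "(\<forall>j\<in>{1..Suc n}. append_var n V Y j \<omega> = append_var n V Y j \<omega>')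
        \<longleftrightarrow> (\<forall>j\<in>{1..n}. V j \<omega> = V j \<omega>') \<and> Y \<omega> = Y \<omega>'"
      by (auto simp: atLeastAtMostSuc_conv append_var_def)
    then show "tuple {1..Suc n} (append_var n V Y) \<omega> = tuple {1..Suc n} (append_var n V Y) \<omega>'
        \<longleftrightarrow> (tuple {1..n} V \<omega>, Y \<omega>) = (tuple {1..n} V \<omega>', Y \<omega>')"
      by (simp only: tuple_eq_iff prod.inject)
  qed
  have "total_correlation M {1..Suc n} (append_var n V Y) =
      (\<Sum>i\<in>{1..Suc n}. entropy2 M (append_var n V Y i)) - entropy2 M (tuple {1..Suc n} (append_var n V Y))"
    using sf by (intro total_correlation_eq_entropy prob_space_axioms) auto
  also have "(\<Sum>i\<in>{1..Suc n}. entropy2 M (append_var n V Y i)) = (\<Sum>i\<in>{1..n}. entropy2 M (V i)) + entropy2 M (Y)"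
    using H1 H2 by simp
  finally show ?thesis by (simp only: H3)
qed

end

theory Submission
  imports Defs
begin

text \<open>
  Write \<open>V\<^sub>i\<close> for the variable generated from \<open>(X\<^sub>i, Y)\<close>. The middle term is
  \<open>TC(X|Y) - TC(V|Y) - (\<Sum>i. I(V\<^sub>i; Y))\<close>. Exchanging \<open>X\<close> and \<open>V\<close> by the chain rule, together with
  \<open>H(V | X, Y) = (\<Sum>i. H(V\<^sub>i | X\<^sub>i, Y))\<close> from the factorization, turns it into
  \<open>(\<Sum>i. H(X\<^sub>i | V\<^sub>i, Y)) - H(X | V, Y) - (\<Sum>i. I(V\<^sub>i; Y))\<close>. The upper bound holds because the last two
  quantities are nonnegative, the lower bound because conditional entropy is subadditive and
  decreases under further conditioning.
\<close>

text \<open>A simple function has only finitely many level sets, so the null ones have a null union.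
  This makes logarithms of level set probabilities meaningful almost everywhere.\<close>

lemma (in prob_space) AE_prob_level_set_pos:
  assumes X: "simple_function M X"
  shows "AE \<omega> in M. 0 < prob (X -` {X \<omega>} \<inter> space M)"
proof -
  let ?N = "{x \<in> X ` space M. prob (X -` {x} \<inter> space M) = 0}"
  have "AE \<omega> in M. \<omega> \<notin> (\<Union>x\<in>?N. X -` {x} \<inter> space M)"
    by (intro AE_not_in null_sets_UN')
      (use X in \<open>auto intro!: countable_finite simp: null_sets_def emeasure_eq_measure dest: simple_functionD\<close>)
  then show ?thesis
    using AE_space by eventually_elim (auto simp: less_le)
qed

section \<open>Entropy and mutual information over enlarged finite alphabets\<close>

context information_space
begin

text \<open>Outside the range the level set is empty, so the same formula is a density over every
  finite superset. Pairs call for this: their range may be a proper subset of the product of the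
  ranges.\<close>

lemma simple_function_distributed_superset:
  assumes X: "simple_function M X" and R: "X ` space M \<subseteq> R" "finite R"
  shows "distributed M (count_space R) X (\<lambda>x. ennreal (prob (X -` {x} \<inter> space M)))"
proof -
  have "distributed M (count_space R) X
      (\<lambda>x. ennreal (if x \<in> X ` space M then prob (X -` {x} \<inter> space M) else 0))"
    by (rule distributed_simple_function_superset[OF X _ R]) simp
  moreover have "(if x \<in> X ` space M then prob (X -` {x} \<inter> space M) else 0) = prob (X -` {x} \<inter> space M)" for x
  proof -
    have "x \<notin> X ` space M \<Longrightarrow> X -` {x} \<inter> space M = {}" by auto
    then show ?thesis by auto
  qed
  ultimately show ?thesis by simp
qed

text \<open>Once the sum over \<open>R\<close> is rewritten as an expectation over \<open>M\<close>,
  it no longer refers to \<open>R\<close>.\<close>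

lemma entropy_count_space_superset:
  assumes X: "simple_function M X" and R: "X ` space M \<subseteq> R" "finite R"
  shows "entropy b (count_space R) X = \<H>(X)"
proof -
  note D = simple_function_distributed_superset[OF X R]
  have "entropy b (count_space R) X
      = - (\<integral>x. prob (X -` {x} \<inter> space M) * log b (prob (X -` {x} \<inter> space M)) \<partial>count_space R)"
    using entropy_distr[OF D] by simp
  also have "\<dots> = - (\<integral>\<omega>. log b (prob (X -` {X \<omega>} \<inter> space M)) \<partial>M)"
    by (subst distributed_integral[OF D]) auto
  finally show ?thesis
    using entropy_simple_function[OF X] by simp
qed

text \<open>The joint entropy in the general identity lives on \<open>R \<times> S\<close>, which
  may exceed the range of the pair; invariance under enlarging the alphabet brings all three
  entropies back to the ranges.\<close>

lemma mutual_information_count_space_superset: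
  assumes X: "simple_function M X" and R: "X ` space M \<subseteq> R" "finite R"
    and Y: "simple_function M Y" and S: "Y ` space M \<subseteq> S" "finite S"
  shows "mutual_information b (count_space R) (count_space S) X Y
    = \<H>(X) + \<H>(Y) - \<H>(\<lambda>\<omega>. (X \<omega>, Y \<omega>))"
proof -
  have XY: "simple_function M (\<lambda>\<omega>. (X \<omega>, Y \<omega>))"
    using X Y by (rule simple_function_Pair)
  have RS: "(\<lambda>\<omega>. (X \<omega>, Y \<omega>)) ` space M \<subseteq> R \<times> S" "finite (R \<times> S)"
    using R S by auto
  have eq: "count_space R \<Otimes>\<^sub>M count_space S = count_space (R \<times> S)"
    using R S by (simp add: pair_measure_count_space)
  have "mutual_information b (count_space R) (count_space S) X Y
      = entropy b (count_space R) X + entropy b (count_space S) Y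
        - entropy b (count_space R \<Otimes>\<^sub>M count_space S) (\<lambda>\<omega>. (X \<omega>, Y \<omega>))"
    by (rule mutual_information_eq_entropy_conditional_entropy_distr
        [OF sigma_finite_measure_count_space_finite[OF R(2)] sigma_finite_measure_count_space_finite[OF S(2)]
          simple_function_distributed_superset[OF X R] _ simple_function_distributed_superset[OF Y S] _
          simple_function_distributed_superset[OF XY RS, folded eq]])
      (use RS in \<open>auto simp: eq intro!: integrable_count_space\<close>)
  then show ?thesis
    unfolding eq using entropy_count_space_superset[OF X R] entropy_count_space_superset[OF Y S]
      entropy_count_space_superset[OF XY RS] by simp
qed

section \<open>Strong subadditivity and inequalities for conditional entropy\<close>

text \<open>This is \<open>I(X ; Y | Z) \<ge> 0\<close> with
  \<open>I(X ; Y | Z) = I(X ; (Y, Z)) - I(X ; Z)\<close> expanded into entropies.\<close>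

lemma entropy_strong_subadditive:
  assumes X: "simple_function M X" and Y: "simple_function M Y" and Z: "simple_function M Z"
  shows "\<H>(\<lambda>\<omega>. (X \<omega>, Y \<omega>, Z \<omega>)) + \<H>(Z) \<le> \<H>(\<lambda>\<omega>. (X \<omega>, Z \<omega>)) + \<H>(\<lambda>\<omega>. (Y \<omega>, Z \<omega>))"
proof -
  note fin = simple_functionD(1)
  have eq: "count_space (Y ` space M) \<Otimes>\<^sub>M count_space (Z ` space M) = count_space (Y ` space M \<times> Z ` space M)"
    using fin[OF Y] fin[OF Z] by (simp add: pair_measure_count_space)
  \<comment> \<open>Conditional mutual information takes \<open>(Y, Z)\<close> over the product of
    the two ranges, not over the range of the pair.\<close>
  have "mutual_information b (count_space (X ` space M)) (count_space (Y ` space M \<times> Z ` space M)) X (\<lambda>\<omega>. (Y \<omega>, Z \<omega>))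
      = \<H>(X) + \<H>(\<lambda>\<omega>. (Y \<omega>, Z \<omega>)) - \<H>(\<lambda>\<omega>. (X \<omega>, Y \<omega>, Z \<omega>))"
    using fin[OF X] fin[OF Y] fin[OF Z]
    by (intro mutual_information_count_space_superset X simple_function_Pair[OF Y Z]) auto
  moreover have "\<I>(X ; Z) = \<H>(X) + \<H>(Z) - \<H>(\<lambda>\<omega>. (X \<omega>, Z \<omega>))"
    using fin[OF X] fin[OF Z] by (intro mutual_information_count_space_superset X Z) auto
  ultimately show ?thesis
    using conditional_mutual_information_nonneg[OF X Y Z]
    unfolding conditional_mutual_information_def eq by linarith
qed

lemma conditional_entropy_eq_entropy_diff:
  assumes X: "simple_function M X" and Y: "simple_function M Y"
  shows "\<H>(X | Y) = \<H>(\<lambda>\<omega>. (Y \<omega>, X \<omega>)) - \<H>(Y)"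
  using entropy_chain_rule[OF Y X] by simp

end

text \<open>Both \<open>H(F | G, Y) + H(G | Y)\<close> and \<open>H(F | Y) + H(G | F, Y)\<close>
  equal \<open>H(F, G | Y)\<close>. The auxiliary equations only permute components, which preserves
  level sets.\<close>

lemma conditional_entropy_exchange:
  assumes "prob_space M" and F: "simple_function M F" and G: "simple_function M G" and Y: "simple_function M Y"
  shows "conditional_entropy2 M F (\<lambda>\<omega>. (G \<omega>, Y \<omega>))
    = conditional_entropy2 M F Y + conditional_entropy2 M G (\<lambda>\<omega>. (F \<omega>, Y \<omega>)) - conditional_entropy2 M G Y"
proof -
  interpret prob_space M by fact
  interpret information_space M 2 by standard simp
  note P = simple_function_Pair
  note sf = prob_space_axioms P F G Y
  have 1: "entropy2 M (\<lambda>\<omega>. ((G \<omega>, Y \<omega>), F \<omega>)) = entropy2 M (\<lambda>\<omega>. ((F \<omega>, Y \<omega>), G \<omega>))"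
    by (intro entropy_cong_level_sets sf) auto
  have 2: "entropy2 M (\<lambda>\<omega>. (G \<omega>, Y \<omega>)) = entropy2 M (\<lambda>\<omega>. (Y \<omega>, G \<omega>))"
    by (intro entropy_cong_level_sets sf) auto
  have 3: "entropy2 M (\<lambda>\<omega>. (F \<omega>, Y \<omega>)) = entropy2 M (\<lambda>\<omega>. (Y \<omega>, F \<omega>))"
    by (intro entropy_cong_level_sets sf) auto
  show ?thesis
    unfolding conditional_entropy_eq_entropy_diff[OF F P[OF G Y]] conditional_entropy_eq_entropy_diff[OF G P[OF F Y]]
      conditional_entropy_eq_entropy_diff[OF F Y] conditional_entropy_eq_entropy_diff[OF G Y] 1 2 3
    by linarith
qed

text \<open>By the chain rule each new index \<open>k\<close> adds
  \<open>H(X k | W, earlier)\<close>, which is at most \<open>H(X k | U k)\<close> because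
  \<open>U k\<close> is determined by \<open>W\<close>. Subadditivity and the weakening of the
  condition are thus handled in one induction.\<close>

lemma conditional_entropy_tuple_le:
  assumes "prob_space M" and "finite J"
    and "\<And>j. j \<in> J \<Longrightarrow> simple_function M (X j)" and W: "simple_function M W"
    and "\<And>j. j \<in> J \<Longrightarrow> simple_function M (U j)"
    and "\<And>j \<omega> \<omega>'. j \<in> J \<Longrightarrow> W \<omega> = W \<omega>' \<Longrightarrow> U j \<omega> = U j \<omega>'"
  shows "conditional_entropy2 M (tuple J X) W \<le> (\<Sum>j\<in>J. conditional_entropy2 M (X j) (U j))"
proof -
  interpret prob_space M by fact
  interpret information_space M 2 by standard simp
  show ?thesis
    using assms(2,3,5,6)
  proof (induction J)
    case empty
    \<comment> \<open>The empty tuple is constant, so both sides are 0.\<close>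
    have "simple_function M (tuple {} X)" by (rule simple_function_tuple) auto
    moreover from this have "entropy2 M (\<lambda>\<omega>. (W \<omega>, tuple {} X \<omega>)) = entropy2 M W"
      by (intro entropy_cong_level_sets prob_space_axioms simple_function_Pair W)
        (auto simp: tuple_eq_iff)
    ultimately show ?case
      using W by (simp add: conditional_entropy_eq_entropy_diff)
  next
    case (insert k J)
    let ?T = "tuple J X"
    have Xk: "simple_function M (X k)" and Uk: "simple_function M (U k)"
      and T: "simple_function M ?T" and T': "simple_function M (tuple (insert k J) X)"
      using insert.prems(1,2) insert.hyps(1) by (auto intro!: simple_function_tuple)
    have dep: "U k \<omega> = U k \<omega>'" if "W \<omega> = W \<omega>'" for \<omega> \<omega>'
      using insert.prems(3)[OF insertI1 that] .
    note sf = prob_space_axioms simple_function_Pair Xk Uk T T' W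
    \<comment> \<open>Being determined by \<open>W\<close>, the component \<open>U k\<close> can be
      adjoined without changing level sets. This produces the shape of strong subadditivity with
      \<open>U k\<close> as the conditioning variable.\<close>
    have 1: "entropy2 M (\<lambda>\<omega>. (W \<omega>, tuple (insert k J) X \<omega>)) = entropy2 M (\<lambda>\<omega>. (X k \<omega>, (W \<omega>, ?T \<omega>), U k \<omega>))"
      by (intro entropy_cong_level_sets sf) (auto simp: tuple_eq_iff intro: dep)
    have 2: "entropy2 M (\<lambda>\<omega>. ((W \<omega>, ?T \<omega>), U k \<omega>)) = entropy2 M (\<lambda>\<omega>. (W \<omega>, ?T \<omega>))"
      by (intro entropy_cong_level_sets sf) (auto intro: dep)
    have 3: "entropy2 M (\<lambda>\<omega>. (X k \<omega>, U k \<omega>)) = entropy2 M (\<lambda>\<omega>. (U k \<omega>, X k \<omega>))"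
      by (intro entropy_cong_level_sets sf) auto
    have "entropy2 M (\<lambda>\<omega>. (X k \<omega>, (W \<omega>, ?T \<omega>), U k \<omega>)) + entropy2 M (U k)
        \<le> entropy2 M (\<lambda>\<omega>. (X k \<omega>, U k \<omega>)) + entropy2 M (\<lambda>\<omega>. ((W \<omega>, ?T \<omega>), U k \<omega>))"
      by (intro entropy_strong_subadditive sf)
    then have "conditional_entropy2 M (tuple (insert k J) X) W \<le> conditional_entropy2 M (X k) (U k) + conditional_entropy2 M ?T W"
      unfolding conditional_entropy_eq_entropy_diff[OF T' W] conditional_entropy_eq_entropy_diff[OF Xk Uk]
        conditional_entropy_eq_entropy_diff[OF T W] 1 2 3 by linarith
    also have "conditional_entropy2 M ?T W \<le> (\<Sum>j\<in>J. conditional_entropy2 M (X j) (U j))"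
      by (rule insert.IH) (use insert.prems(1,2) in \<open>auto intro: insert.prems(3)\<close>)
    finally show ?case
      using insert.hyps by simp
  qed
qed

section \<open>Additivity of conditional entropy under the factorization\<close>

text \<open>Taking logarithms in the factorization gives, almost surely, \<open>log p(x,y,v) = log
  p(x,y) + (\<Sum>i. log p(x_i,y,v_i) - log p(x_i,y))\<close>; taking expectations and negating
  yields the claim.\<close>

lemma conditional_entropy_independent_probabilistic_functions:
  assumes "prob_space M" and X: "\<And>i. i \<in> {1..n} \<Longrightarrow> simple_function M (X i)"
    and Y: "simple_function M Y" and V: "\<And>i. i \<in> {1..n} \<Longrightarrow> simple_function M (V i)"
    and ind: "independent_probabilistic_functions M n X Y V"
  shows "conditional_entropy2 M (tuple {1..n} V) (\<lambda>\<omega>. (tuple {1..n} X \<omega>, Y \<omega>))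
    = (\<Sum>i\<in>{1..n}. conditional_entropy2 M (V i) (\<lambda>\<omega>. (X i \<omega>, Y \<omega>)))"
proof -
  interpret prob_space M by fact
  interpret information_space M 2 by standard simp
  let ?J = "{1..n}"
  have TX: "simple_function M (tuple ?J X)" and TV: "simple_function M (tuple ?J V)"
    using X V by (auto intro: simple_function_tuple)
  \<comment> \<open>The level sets of \<open>A\<close>, \<open>B\<close>, \<open>C i\<close>,
    \<open>D i\<close> carry \<open>p(x,y,v)\<close>, \<open>p(x,y)\<close>,
    \<open>p(x_i,y,v_i)\<close>, \<open>p(x_i,y)\<close>.\<close>
  define A where "A = (\<lambda>\<omega>. ((tuple ?J X \<omega>, Y \<omega>), tuple ?J V \<omega>))"
  define B where "B = (\<lambda>\<omega>. (tuple ?J X \<omega>, Y \<omega>))"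
  define C where "C i = (\<lambda>\<omega>. ((X i \<omega>, Y \<omega>), V i \<omega>))" for i
  define D where "D i = (\<lambda>\<omega>. (X i \<omega>, Y \<omega>))" for i
  have A: "simple_function M A" and B: "simple_function M B"
    and C: "i \<in> ?J \<Longrightarrow> simple_function M (C i)" and D: "i \<in> ?J \<Longrightarrow> simple_function M (D i)" for i
    unfolding A_def B_def C_def D_def using TX TV X Y V by (auto intro!: simple_function_Pair)
  have int: "integrable M (\<lambda>\<omega>. log 2 (prob (F -` {F \<omega>} \<inter> space M)))" if "simple_function M F" for F :: "'a \<Rightarrow> 'e"
  proof -
    have "simple_function M (\<lambda>\<omega>. log 2 (prob (F -` {F \<omega>} \<inter> space M)))"
      using simple_function_compose[OF that, of "\<lambda>x. log 2 (prob (F -` {x} \<inter> space M))"] by (simp add: comp_def)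
    then show ?thesis
      by (rule integrable_simple_function) (simp add: emeasure_eq_measure)
  qed
  have "AE \<omega> in M. log 2 (prob (A -` {A \<omega>} \<inter> space M)) = log 2 (prob (B -` {B \<omega>} \<inter> space M))
      + (\<Sum>i\<in>?J. log 2 (prob (C i -` {C i \<omega>} \<inter> space M)) - log 2 (prob (D i -` {D i \<omega>} \<inter> space M)))"
    using AE_prob_level_set_pos[OF A]
  proof eventually_elim
    case (elim \<omega>)
    define c where "c i = prob (C i -` {C i \<omega>} \<inter> space M)" for i
    define d where "d i = prob (D i -` {D i \<omega>} \<inter> space M)" for i
    let ?X = "{\<omega>' \<in> space M. \<forall>i\<in>?J. X i \<omega>' = X i \<omega>}"
    have Aeq: "A -` {A \<omega>} \<inter> space M = {\<omega>' \<in> space M. (\<forall>i\<in>?J. X i \<omega>' = X i \<omega>) \<and> Y \<omega>' = Y \<omega> \<and> (\<forall>i\<in>?J. V i \<omega>' = V i \<omega>)}"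
      by (auto simp: A_def tuple_eq_iff)
    have Beq: "B -` {B \<omega>} \<inter> space M = {\<omega>' \<in> space M. Y \<omega>' = Y \<omega> \<and> (\<forall>i\<in>?J. X i \<omega>' = X i \<omega>)}"
      by (auto simp: B_def tuple_eq_iff)
    have Ceq: "C i -` {C i \<omega>} \<inter> space M = {\<omega>' \<in> space M. V i \<omega>' = V i \<omega> \<and> X i \<omega>' = X i \<omega> \<and> Y \<omega>' = Y \<omega>}" for i
      by (auto simp: C_def)
    have Deq: "D i -` {D i \<omega>} \<inter> space M = {\<omega>' \<in> space M. X i \<omega>' = X i \<omega> \<and> Y \<omega>' = Y \<omega>}" for i
      by (auto simp: D_def)
    \<comment> \<open>The factorization at the values attained at \<open>\<omega>\<close>, with each
      conditional probability unfolded to a quotient.\<close>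
    have *: "prob (A -` {A \<omega>} \<inter> space M) = prob ?X * (prob (B -` {B \<omega>} \<inter> space M) / prob ?X) * (\<Prod>i\<in>?J. c i / d i)"
      using ind[unfolded independent_probabilistic_functions_def, rule_format, of "\<lambda>i. X i \<omega>" "Y \<omega>" "\<lambda>i. V i \<omega>"]
      unfolding Aeq Beq c_def d_def Ceq Deq cond_prob_def by simp
    \<comment> \<open>The left side of \<open>*\<close> is positive at this \<open>\<omega>\<close>,
      so no factor on the right vanishes. This excludes the default value 0 of quotients by 0 and
      lets \<open>p(x)\<close> cancel.\<close>
    have cancel: "p \<noteq> 0" "q \<noteq> 0" "r \<noteq> 0" if "p * (q / p) * r \<noteq> 0" for p q r :: real
      using that by auto
    note nz = cancel[OF less_imp_neq[OF elim[unfolded *], symmetric]]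
    have cd: "c i \<noteq> 0" "d i \<noteq> 0" if "i \<in> ?J" for i
    proof -
      have "c i / d i \<noteq> 0"
        using nz(3) that prod_zero_iff[of ?J "\<lambda>i. c i / d i"] by blast
      then show "c i \<noteq> 0" "d i \<noteq> 0" by auto
    qed
    then have pos: "0 < c i" "0 < d i" if "i \<in> ?J" for i
      using that by (auto simp: c_def d_def less_le)
    have "log 2 (prob (A -` {A \<omega>} \<inter> space M)) = log 2 (prob (B -` {B \<omega>} \<inter> space M) * (\<Prod>i\<in>?J. c i / d i))"
      unfolding * using nz(1) by simp
    also have "\<dots> = log 2 (prob (B -` {B \<omega>} \<inter> space M)) + log 2 (\<Prod>i\<in>?J. c i / d i)"
      using nz(2) pos by (intro log_mult_pos prod_pos) (auto simp: less_le)
    also have "log 2 (\<Prod>i\<in>?J. c i / d i) = (\<Sum>i\<in>?J. log 2 (c i / d i))"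
      unfolding log_def using cd by (subst ln_prod) (auto simp: sum_divide_distrib)
    also have "\<dots> = (\<Sum>i\<in>?J. log 2 (c i) - log 2 (d i))"
      using pos by (intro sum.cong refl log_divide_pos)
    finally show ?case by (simp add: c_def d_def)
  qed
  then have "(\<integral>\<omega>. log 2 (prob (A -` {A \<omega>} \<inter> space M)) \<partial>M) = (\<integral>\<omega>. log 2 (prob (B -` {B \<omega>} \<inter> space M))
      + (\<Sum>i\<in>?J. log 2 (prob (C i -` {C i \<omega>} \<inter> space M)) - log 2 (prob (D i -` {D i \<omega>} \<inter> space M))) \<partial>M)"
    using int[OF A] int[OF B] int[OF C] int[OF D]
    by (intro integral_cong_AE borel_measurable_add borel_measurable_sum borel_measurable_diff borel_measurable_integrable)
  also have "\<dots> = (\<integral>\<omega>. log 2 (prob (B -` {B \<omega>} \<inter> space M)) \<partial>M)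
      + (\<Sum>i\<in>?J. (\<integral>\<omega>. log 2 (prob (C i -` {C i \<omega>} \<inter> space M)) \<partial>M) - (\<integral>\<omega>. log 2 (prob (D i -` {D i \<omega>} \<inter> space M)) \<partial>M))"
    using int[OF B] int[OF C] int[OF D]
    by (subst Bochner_Integration.integral_add)
      (auto simp: Bochner_Integration.integral_sum intro!: sum.cong Bochner_Integration.integral_diff
        Bochner_Integration.integrable_sum Bochner_Integration.integrable_diff)
  \<comment> \<open>Entropy is minus the expected logarithm, so \<open>C i\<close> and
    \<open>D i\<close> trade places.\<close>
  also have "\<dots> = - entropy2 M B + (\<Sum>i\<in>?J. entropy2 M (D i) - entropy2 M (C i))"
    using entropy_simple_function[OF B] entropy_simple_function[OF C] entropy_simple_function[OF D] by simp
  finally have "entropy2 M A - entropy2 M B = (\<Sum>i\<in>?J. entropy2 M (C i) - entropy2 M (D i))"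
    by (simp add: entropy_simple_function[OF A] sum_subtractf)
  moreover have "conditional_entropy2 M (tuple ?J V) B = entropy2 M A - entropy2 M B"
    unfolding conditional_entropy_eq_entropy_diff[OF TV B] by (simp add: A_def B_def)
  moreover have "conditional_entropy2 M (V i) (D i) = entropy2 M (C i) - entropy2 M (D i)" if "i \<in> ?J" for i
    unfolding conditional_entropy_eq_entropy_diff[OF V[OF that] D[OF that]] by (simp add: C_def D_def)
  ultimately show ?thesis
    by (simp add: B_def D_def)
qed

section \<open>Combining the entropy identities into the two bounds\<close>

theorem theorem2p1:
  fixes M :: "'a measure" and n :: nat
    and X :: "nat \<Rightarrow> 'a \<Rightarrow> 'b" and Y :: "'a \<Rightarrow> 'c" and Xbar :: "nat \<Rightarrow> 'a \<Rightarrow> 'd"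
    and f :: "(nat \<Rightarrow> 'b) \<Rightarrow> 'c"
  assumes "prob_space M"
    and "\<And>i. i \<in> {1..n} \<Longrightarrow> simple_function M (X i)"
    and "simple_function M Y"
    and "\<And>i. i \<in> {1..n} \<Longrightarrow> simple_function M (Xbar i)"
    and "AE \<omega> in M. Y \<omega> = f (tuple {1..n} X \<omega>)"
    and "independent_probabilistic_functions M n X Y Xbar"
  shows "- (\<Sum>i\<in>{1..n}. mutual_information2 M (Xbar i) Y)
           \<le> total_correlation M {1..n} X
              - (total_correlation M {1..Suc n} (append_var n Xbar Y)
                 + total_correlation_reduction M {1..n} X Y)
       \<and> total_correlation M {1..n} X
              - (total_correlation M {1..Suc n} (append_var n Xbar Y)
                 + total_correlation_reduction M {1..n} X Y)
           \<le> (\<Sum>i\<in>{1..n}. conditional_entropy2 M (X i) (\<lambda>\<omega>. (Xbar i \<omega>, Y \<omega>)))"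
proof -
  interpret prob_space M by fact
  interpret information_space M 2 by standard simp
  let ?J = "{1..n}"
  note X = assms(2) and Y = assms(3) and V = assms(4)
  let ?X = "tuple ?J X" and ?V = "tuple ?J Xbar"
  let ?W = "\<lambda>\<omega>. (?V \<omega>, Y \<omega>)"
  have TX: "simple_function M ?X" and TV: "simple_function M ?V"
    using X V by (auto intro: simple_function_tuple)
  note P = simple_function_Pair
  have W: "simple_function M ?W" by (rule P[OF TV Y])
  let ?Q = "total_correlation M ?J X
    - (total_correlation M {1..Suc n} (append_var n Xbar Y) + total_correlation_reduction M ?J X Y)"
  \<comment> \<open>\<open>H(V | X, Y)\<close> is evaluated twice: by exchanging the full tuples,
    and by splitting over \<open>i\<close> and exchanging each pair.\<close>
  have "conditional_entropy2 M ?V Y + conditional_entropy2 M ?X ?W - conditional_entropy2 M ?X Y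
      = conditional_entropy2 M ?V (\<lambda>\<omega>. (?X \<omega>, Y \<omega>))"
    by (rule conditional_entropy_exchange[OF prob_space_axioms TV TX Y, symmetric])
  also have "\<dots> = (\<Sum>i\<in>?J. conditional_entropy2 M (Xbar i) (\<lambda>\<omega>. (X i \<omega>, Y \<omega>)))"
    using prob_space_axioms X Y V assms(6) by (rule conditional_entropy_independent_probabilistic_functions)
  also have "\<dots> = (\<Sum>i\<in>?J. conditional_entropy2 M (Xbar i) Y
      + conditional_entropy2 M (X i) (\<lambda>\<omega>. (Xbar i \<omega>, Y \<omega>)) - conditional_entropy2 M (X i) Y)"
    using X V Y by (intro sum.cong refl conditional_entropy_exchange prob_space_axioms)
  finally have eqV: "conditional_entropy2 M ?V Y + conditional_entropy2 M ?X ?W - conditional_entropy2 M ?X Y = \<dots>" .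
  have "entropy2 M ?W = entropy2 M (\<lambda>\<omega>. (Y \<omega>, ?V \<omega>))"
    by (intro entropy_cong_level_sets prob_space_axioms P TV Y) auto
  then have "entropy2 M ?W = entropy2 M Y + conditional_entropy2 M ?V Y"
    using entropy_chain_rule[OF Y TV] by simp
  moreover have "(\<Sum>i\<in>?J. mutual_information2 M (Xbar i) Y) = (\<Sum>i\<in>?J. entropy2 M (Xbar i) - conditional_entropy2 M (Xbar i) Y)"
    using V Y by (intro sum.cong mutual_information_eq_entropy_conditional_entropy) auto
  \<comment> \<open>\<open>TC(X) - TC(X;Y)\<close> collapses to \<open>TC(X|Y)\<close>, and the two
    preceding facts give \<open>TC(Xbar) = TC(V|Y) + (\<Sum>i. I(V_i;Y))\<close>; \<open>eqV\<close>
    then trades entropies given \<open>Y\<close> for those of \<open>X\<close> given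
    \<open>V\<close> and \<open>Y\<close>.\<close>
  ultimately have Q: "?Q = (\<Sum>i\<in>?J. conditional_entropy2 M (X i) (\<lambda>\<omega>. (Xbar i \<omega>, Y \<omega>))) - conditional_entropy2 M ?X ?W - (\<Sum>i\<in>?J. mutual_information2 M (Xbar i) Y)"
    using eqV total_correlation_append_var[OF prob_space_axioms V Y]
    unfolding total_correlation_reduction_def conditional_total_correlation_def
    by (simp add: sum.distrib sum_subtractf)
  \<comment> \<open>Each \<open>(Xbar i, Y)\<close> is determined by \<open>?W\<close>, so it can
    serve as \<open>U i\<close>; this is the lower bound.\<close>
  have "conditional_entropy2 M ?X ?W \<le> (\<Sum>i\<in>?J. conditional_entropy2 M (X i) (\<lambda>\<omega>. (Xbar i \<omega>, Y \<omega>)))"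
    using X V Y TV by (intro conditional_entropy_tuple_le prob_space_axioms P) (auto simp: tuple_eq_iff)
  moreover have "0 \<le> conditional_entropy2 M ?X ?W"
    by (rule conditional_entropy_nonneg[OF TX W])
  moreover have "0 \<le> (\<Sum>i\<in>?J. mutual_information2 M (Xbar i) Y)"
    using V Y by (intro sum_nonneg mutual_information_nonneg_simple)
  ultimately show ?thesis
    unfolding Q by simp
qed

end
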